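(* There exist four-dimensional solvable real Lie groups endowed with left-invariant complex structures which admit non-Kähler strong-second-Chern-Einstein Hermitian metrics with negative Einstein factor; that is, Hermitian metrics $\omega$ with $d\omega\neq0$ and $\mathrm{Ric}^{(2)}(\omega)=\lambda\,\omega$ for some constant $\lambda<0$.
   Context: A Hermitian metric on a complex manifold is identified with its positive $(1,1)$-form, locally $\omega=\sqrt{-1}\,h_{k\bar\ell}\,dz^k\wedge d\bar z^\ell$. The curvature of the Chern connection of the holomorphic tangent bundle (the unique Hermitian connection extending $\bar\partial$) has components $$\Theta_{i\bar jk\bar\ell}=-\frac{\partial^2 h_{k\bar\ell}}{\partial z^i\partial\bar z^j}+h^{p\bar q}\frac{\partial h_{k\bar q}}{\partial z^i}\frac{\partial h_{p\bar\ell}}{\partial\bar z^j},$$ and the second Chern-Ricci form is $\mathrm{Ric}^{(2)}(\omega)=h^{i\bar j}\Theta_{i\bar jk\bar\ell}\,\sqrt{-1}\,dz^k\wedge d\bar z^\ell$. A metric is strong-second-Chern-Einstein if $\mathrm{Ric}^{(2)}(\omega)=\lambda\omega$ with $\lambda$ a real constant, called the Einstein factor. The metric is Kähler if $d\omega=0$. *)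

theory Defs
  imports "HOL-Analysis.Analysis" "HOL-Algebra.Solvable_Groups"
begin

section \<open>Smooth and holomorphic maps between open sets\<close>

text \<open>These predicates are meant for open \<open>S\<close> only.\<close>

fun Ck_on :: "nat \<Rightarrow> 'a::real_normed_vector set \<Rightarrow> ('a \<Rightarrow> 'b::real_normed_vector) \<Rightarrow> bool" where
  "Ck_on 0 S f \<longleftrightarrow> continuous_on S f"
| "Ck_on (Suc k) S f \<longleftrightarrow>
     (\<forall>x\<in>S. f differentiable (at x)) \<and>
     (\<forall>v. Ck_on k S (\<lambda>x. frechet_derivative f (at x) v))"

definition smooth_on :: "'a::real_normed_vector set \<Rightarrow> ('a \<Rightarrow> 'b::real_normed_vector) \<Rightarrow> bool" where
  "smooth_on S f \<longleftrightarrow> (\<forall>k. Ck_on k S f)"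

definition holomorphic_vec_on :: "(complex^'n) set \<Rightarrow> (complex^'n \<Rightarrow> complex^'m) \<Rightarrow> bool" where
  "holomorphic_vec_on S f \<longleftrightarrow>
     (\<forall>z\<in>S. \<exists>f'. (f has_derivative f') (at z) \<and> (\<forall>c v. f' (c *s v) = c *s f' v))"


section \<open>Manifolds\<close>

text \<open>A chart consists of its domain and its coordinate map.\<close>

type_synonym ('g, 'e) chart = "'g set \<times> ('g \<Rightarrow> 'e)"

definition is_chart :: "'g topology \<Rightarrow> ('g, 'e::euclidean_space) chart \<Rightarrow> bool" where
  "is_chart X c \<longleftrightarrow>
     openin X (fst c) \<and> open (snd c ` fst c) \<and>
     homeomorphic_map (subtopology X (fst c)) (top_of_set (snd c ` fst c)) (snd c)"

definition chart_inv :: "('g, 'e) chart \<Rightarrow> 'e \<Rightarrow> 'g" where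
  "chart_inv c = inv_into (fst c) (snd c)"

definition transition_dom :: "('g, 'e) chart \<Rightarrow> ('g, 'f) chart \<Rightarrow> 'e set" where
  "transition_dom c d = snd c ` (fst c \<inter> fst d)"

definition transition :: "('g, 'e) chart \<Rightarrow> ('g, 'f) chart \<Rightarrow> 'e \<Rightarrow> 'f" where
  "transition c d = snd d \<circ> chart_inv c"

text \<open>The two charts may have different model spaces, e.g. \<open>\<real>\<^sup>4\<close> and \<open>\<complex>\<^sup>2\<close>.\<close>

definition smooth_compatible ::
  "('g, 'e::euclidean_space) chart \<Rightarrow> ('g, 'f::euclidean_space) chart \<Rightarrow> bool" where
  "smooth_compatible c d \<longleftrightarrow>
     smooth_on (transition_dom c d) (transition c d) \<and>
     smooth_on (transition_dom d c) (transition d c)"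

locale smooth_manifold =
  fixes X :: "'g topology" and A :: "('g, 'e::euclidean_space) chart set"
  assumes hausdorff: "Hausdorff_space X"
    and second_countable: "second_countable X"
    and charts: "c \<in> A \<Longrightarrow> is_chart X c"
    and cover: "(\<Union>c\<in>A. fst c) = topspace X"
    and compatible: "c \<in> A \<Longrightarrow> d \<in> A \<Longrightarrow> smooth_compatible c d"

definition smooth_map ::
  "'g topology \<Rightarrow> ('g, 'e::euclidean_space) chart set \<Rightarrow>
   'h topology \<Rightarrow> ('h, 'f::euclidean_space) chart set \<Rightarrow> ('g \<Rightarrow> 'h) \<Rightarrow> bool" where
  "smooth_map X A Y B f \<longleftrightarrow>
     continuous_map X Y f \<and>
     (\<forall>c\<in>A. \<forall>d\<in>B.
        smooth_on (snd c ` {p \<in> fst c. f p \<in> fst d}) (snd d \<circ> f \<circ> chart_inv c))"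

definition product_atlas ::
  "('g, 'e) chart set \<Rightarrow> ('h, 'f) chart set \<Rightarrow> ('g \<times> 'h, 'e \<times> 'f) chart set" where
  "product_atlas A B = (\<lambda>(c, d). (fst c \<times> fst d, map_prod (snd c) (snd d))) ` (A \<times> B)"

definition holomorphic_map ::
  "'g topology \<Rightarrow> ('g, complex^'n) chart set \<Rightarrow>
   'h topology \<Rightarrow> ('h, complex^'m) chart set \<Rightarrow> ('g \<Rightarrow> 'h) \<Rightarrow> bool" where
  "holomorphic_map X A Y B f \<longleftrightarrow>
     continuous_map X Y f \<and>
     (\<forall>c\<in>A. \<forall>d\<in>B.
        holomorphic_vec_on (snd c ` {p \<in> fst c. f p \<in> fst d}) (snd d \<circ> f \<circ> chart_inv c))"

text \<open>A complex structure on a smooth manifold: an atlas with holomorphic transition maps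
  that induces the given smooth structure.\<close>

locale complex_structure = smooth_manifold X A
  for X :: "'g topology" and A :: "('g, 'e::euclidean_space) chart set" +
  fixes B :: "('g, complex^'n) chart set"
  assumes complex_charts: "c \<in> B \<Longrightarrow> is_chart X c"
    and complex_cover: "(\<Union>c\<in>B. fst c) = topspace X"
    and holomorphic_transition:
      "c \<in> B \<Longrightarrow> d \<in> B \<Longrightarrow> holomorphic_vec_on (transition_dom c d) (transition c d)"
    and same_smooth_structure: "a \<in> A \<Longrightarrow> c \<in> B \<Longrightarrow> smooth_compatible a c"


section \<open>Lie groups\<close>

text \<open>The type \<open>'g\<close> only supplies points: neither its topology nor its algebraic structure is
  used, and the underlying set is \<open>carrier G\<close>. Any type of cardinality of the continuum is
  large enough to represent every second countable Lie group.\<close>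

locale lie_group = group G + smooth_manifold X A
  for G :: "'g monoid" (structure)
    and X :: "'g topology" and A :: "('g, 'e::euclidean_space) chart set" +
  assumes carrier_eq: "topspace X = carrier G"
    and smooth_mult:
      "smooth_map (prod_topology X X) (product_atlas A A) X A (\<lambda>(x, y). x \<otimes>\<^bsub>G\<^esub> y)"
    and smooth_inverse: "smooth_map X A X A (m_inv G)"

definition left_invariant :: "'g monoid \<Rightarrow> 'g topology \<Rightarrow> ('g, complex^'n) chart set \<Rightarrow> bool" where
  "left_invariant G X B \<longleftrightarrow>
     (\<forall>g\<in>carrier G. holomorphic_map X B X B (\<lambda>x. g \<otimes>\<^bsub>G\<^esub> x))"


section \<open>Hermitian metrics\<close>

text \<open>The 2-form \<open>\<i> M\<^sub>k\<^sub>l dz\<^sup>k \<and> d\<zeta>\<^sup>l\<close>, where \<open>\<zeta>\<^sup>l\<close> is the conjugate of \<open>z\<^sup>l\<close>, with the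
  convention \<open>(\<alpha> \<and> \<beta>) (u, v) = \<alpha> u \<beta> v - \<alpha> v \<beta> u\<close>.\<close>

definition form11 :: "complex^'n^'n \<Rightarrow> complex^'n \<Rightarrow> complex^'n \<Rightarrow> complex" where
  "form11 M u v = \<i> * (\<Sum>k\<in>UNIV. \<Sum>l\<in>UNIV. M $ k $ l * (u $ k * cnj (v $ l) - v $ k * cnj (u $ l)))"

definition hermitian_posdef :: "complex^'n^'n \<Rightarrow> bool" where
  "hermitian_posdef M \<longleftrightarrow>
     (\<forall>k l. M $ l $ k = cnj (M $ k $ l)) \<and>
     (\<forall>v. v \<noteq> 0 \<longrightarrow> Re (\<Sum>k\<in>UNIV. \<Sum>l\<in>UNIV. M $ k $ l * v $ k * cnj (v $ l)) > 0)"

text \<open>\<open>h c z\<close> is the matrix of metric components in the chart \<open>c\<close> at the coordinate point \<open>z\<close>.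
  The last condition says that the local forms agree on overlaps, i.e. each is the pullback
  of the other under the transition map.\<close>

type_synonym ('g, 'n) local_metrics =
  "('g, complex^'n) chart \<Rightarrow> complex^'n \<Rightarrow> complex^'n^'n"

definition hermitian_metric :: "('g, complex^'n) chart set \<Rightarrow> ('g, 'n::finite) local_metrics \<Rightarrow> bool" where
  "hermitian_metric B h \<longleftrightarrow>
     (\<forall>c\<in>B. smooth_on (snd c ` fst c) (h c) \<and> (\<forall>z\<in>snd c ` fst c. hermitian_posdef (h c z))) \<and>
     (\<forall>c\<in>B. \<forall>d\<in>B. \<forall>z\<in>transition_dom c d. \<forall>u v.
        form11 (h c z) u v =
        form11 (h d (transition c d z))
          (frechet_derivative (transition c d) (at z) u)
          (frechet_derivative (transition c d) (at z) v))"

definition ext_deriv2 ::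
  "('a::real_normed_vector \<Rightarrow> 'a \<Rightarrow> 'a \<Rightarrow> complex) \<Rightarrow> 'a \<Rightarrow> 'a \<Rightarrow> 'a \<Rightarrow> 'a \<Rightarrow> complex" where
  "ext_deriv2 \<omega> z u v w =
     frechet_derivative (\<lambda>x. \<omega> x v w) (at z) u +
     frechet_derivative (\<lambda>x. \<omega> x w u) (at z) v +
     frechet_derivative (\<lambda>x. \<omega> x u v) (at z) w"

definition kahler :: "('g, complex^'n) chart set \<Rightarrow> ('g, 'n::finite) local_metrics \<Rightarrow> bool" where
  "kahler B h \<longleftrightarrow>
     (\<forall>c\<in>B. \<forall>z\<in>snd c ` fst c. \<forall>u v w. ext_deriv2 (\<lambda>x. form11 (h c x)) z u v w = 0)"


section \<open>The second Chern-Ricci form\<close>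

definition d_hol :: "'n \<Rightarrow> (complex^'n \<Rightarrow> complex) \<Rightarrow> complex^'n \<Rightarrow> complex" where
  "d_hol i f z =
     (frechet_derivative f (at z) (axis i 1) - \<i> * frechet_derivative f (at z) (axis i \<i>)) / 2"

definition d_antihol :: "'n \<Rightarrow> (complex^'n \<Rightarrow> complex) \<Rightarrow> complex^'n \<Rightarrow> complex" where
  "d_antihol j f z =
     (frechet_derivative f (at z) (axis j 1) + \<i> * frechet_derivative f (at z) (axis j \<i>)) / 2"

text \<open>Upper indices: \<open>\<Sum>q. upper M p q * M $ k $ q\<close> is the Kronecker delta of \<open>p\<close> and \<open>k\<close>,
  hence the transposition.\<close>

definition upper :: "complex^'n^'n \<Rightarrow> 'n \<Rightarrow> 'n \<Rightarrow> complex" where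
  "upper M p q = matrix_inv M $ q $ p"

definition chern_curvature ::
  "(complex^'n \<Rightarrow> complex^'n^'n) \<Rightarrow> complex^'n \<Rightarrow> 'n \<Rightarrow> 'n \<Rightarrow> 'n \<Rightarrow> 'n \<Rightarrow> complex" where
  "chern_curvature H z i j k l =
     - d_hol i (d_antihol j (\<lambda>x. H x $ k $ l)) z +
     (\<Sum>p\<in>UNIV. \<Sum>q\<in>UNIV.
        upper (H z) p q * d_hol i (\<lambda>x. H x $ k $ q) z * d_antihol j (\<lambda>x. H x $ p $ l) z)"

definition second_chern_ricci :: "(complex^'n \<Rightarrow> complex^'n^'n) \<Rightarrow> complex^'n \<Rightarrow> complex^'n^'n" where
  "second_chern_ricci H z =
     (\<chi> k l. \<Sum>i\<in>UNIV. \<Sum>j\<in>UNIV. upper (H z) i j * chern_curvature H z i j k l)"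

definition strong_second_chern_einstein ::
  "('g, complex^'n) chart set \<Rightarrow> ('g, 'n::finite) local_metrics \<Rightarrow> real \<Rightarrow> bool" where
  "strong_second_chern_einstein B h a \<longleftrightarrow>
     (\<forall>c\<in>B. \<forall>z\<in>snd c ` fst c. \<forall>u v.
        form11 (second_chern_ricci (h c) z) u v = of_real a * form11 (h c z) u v)"

end

theory Submission
  imports Defs
begin

text \<open>
  On \<open>\<complex>\<^sup>n\<close> a metric \<open>u I\<close>, conformal to the flat one, has second Chern-Ricci form
  \<open>- (\<Delta> log u) I\<close>, where \<open>\<Delta> = \<Sum>\<^sub>i \<partial>\<^sup>2/\<partial>z\<^sub>i\<partial>\<zeta>\<^sub>i\<close> and \<open>\<zeta>\<^sub>i\<close> is the conjugate of \<open>z\<^sub>i\<close>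
  (\<open>second_chern_ricci_conformally_flat\<close>). This is a pointwise multiple of the metric for
  every \<open>u\<close>, so \<open>u I\<close> is strong-second-Chern-Einstein exactly when
  \<open>\<Delta> log u = - \<lambda> u\<close>. If \<open>u\<close> depends on \<open>z\<^sub>1\<close> alone, this is Liouville's equation,
  and the Poincare density \<open>u = (Im z\<^sub>1)\<^sup>-\<^sup>2\<close> solves it with \<open>\<lambda> = -1/2\<close>. In complex dimension two
  the form of \<open>u I\<close> is closed only for constant \<open>u\<close>, so this metric on \<open>\<H> \<times> \<complex>\<close>, where \<open>\<H>\<close> is the
  upper half-plane, is not Kaehler.

  The underlying Riemannian metric is that of real hyperbolic 4-space. The maps
  \<open>(z\<^sub>1, z\<^sub>2) \<mapsto> (a z\<^sub>1 + b, a z\<^sub>2 + c)\<close> with \<open>a > 0\<close>, \<open>b\<close> real and \<open>c\<close> complex are holomorphic and act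
  simply transitively on \<open>\<H> \<times> \<complex>\<close>. Their group is the solvable group \<open>\<real> \<ltimes> \<real>\<^sup>3\<close>; moved to the
  half-space \<open>\<real> \<times> (0, \<infinity>) \<times> \<real>\<^sup>2\<close> through the orbit of \<open>(\<i>, 0)\<close>, it is a Lie group with a
  global chart, whose left translations are complex affine maps.
\<close>

section \<open>Calculus of smooth maps on open sets\<close>

lemma frechet_derivative_cong_open:
  assumes "open S" "x \<in> S" "\<And>y. y \<in> S \<Longrightarrow> f y = g y"
  shows "frechet_derivative f (at x) = frechet_derivative g (at x)"
proof -
  have "(f has_derivative D) (at x) \<longleftrightarrow> (g has_derivative D) (at x)" for D
    using assms has_derivative_transform_within_open[of f D x UNIV S g]
      has_derivative_transform_within_open[of g D x UNIV S f] by auto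
  then show ?thesis
    by (simp add: frechet_derivative_def)
qed

lemma Ck_on_cong:
  assumes "open S" "\<And>x. x \<in> S \<Longrightarrow> f x = g x"
  shows "Ck_on k S f \<longleftrightarrow> Ck_on k S g"
  using assms(2)
proof (induction k arbitrary: f g)
  case 0
  then show ?case by (simp cong: continuous_on_cong)
next
  case (Suc k)
  have "f differentiable (at x) \<longleftrightarrow> g differentiable (at x)" if "x \<in> S" for x
    using that Suc.prems assms(1) has_derivative_transform_within_open[of f _ x UNIV S g]
      has_derivative_transform_within_open[of g _ x UNIV S f]
    unfolding differentiable_def by auto
  moreover have "Ck_on k S (\<lambda>x. frechet_derivative f (at x) v) \<longleftrightarrow>
      Ck_on k S (\<lambda>x. frechet_derivative g (at x) v)" for v
    by (rule Suc.IH) (metis Suc.prems assms(1) frechet_derivative_cong_open)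
  ultimately show ?case by auto
qed

lemma smooth_on_cong:
  assumes "open S" "\<And>x. x \<in> S \<Longrightarrow> f x = g x" "smooth_on S g"
  shows "smooth_on S f"
  using assms Ck_on_cong[of S f g] by (auto simp: smooth_on_def)

lemma Ck_on_SucI:
  assumes "open S" "\<And>x. x \<in> S \<Longrightarrow> (f has_derivative D x) (at x)"
    "\<And>v. Ck_on k S (\<lambda>x. D x v)"
  shows "Ck_on (Suc k) S f"
proof -
  have D: "frechet_derivative f (at x) = D x" if "x \<in> S" for x
    using assms(2)[OF that] frechet_derivative_at by metis
  have "Ck_on k S (\<lambda>x. frechet_derivative f (at x) v)" for v
    using Ck_on_cong[OF assms(1), of "\<lambda>x. frechet_derivative f (at x) v" "\<lambda>x. D x v"]
    by (simp add: D assms(3))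
  then show ?thesis
    using assms(2) by (auto simp: differentiable_def)
qed

lemma Ck_on_SucD: "Ck_on (Suc k) S f \<Longrightarrow> Ck_on k S f"
proof (induction k arbitrary: f)
  case 0
  then show ?case
    by (auto intro!: continuous_at_imp_continuous_on differentiable_imp_continuous_within)
next
  case (Suc k)
  then show ?case by (metis Ck_on.simps(2))
qed

lemma Ck_on_const: "Ck_on k S (\<lambda>x. c)"
  by (induction k arbitrary: c) auto

lemma smooth_on_const: "smooth_on S (\<lambda>x. c)"
  by (simp add: smooth_on_def Ck_on_const)

lemma smooth_on_bounded_linear:
  assumes "bounded_linear f"
  shows "smooth_on S f"
proof -
  have D: "frechet_derivative f (at x) = f" for x
    using bounded_linear_imp_has_derivative[OF assms] frechet_derivative_at by metis
  have "Ck_on k S f" for k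
    by (cases k)
      (auto simp: D Ck_on_const bounded_linear_imp_differentiable assms
        intro: linear_continuous_on)
  then show ?thesis
    by (simp add: smooth_on_def)
qed

lemma Ck_on_add:
  assumes "open S" "Ck_on k S f" "Ck_on k S g"
  shows "Ck_on k S (\<lambda>x. f x + g x)"
  using assms(2,3)
proof (induction k arbitrary: f g)
  case 0
  then show ?case by (simp add: continuous_on_add)
next
  case (Suc k)
  then show ?case
    by (intro Ck_on_SucI[OF assms(1), where
          D = "\<lambda>x v. frechet_derivative f (at x) v + frechet_derivative g (at x) v"])
      (auto intro!: has_derivative_add simp: frechet_derivative_works[symmetric])
qed

lemma smooth_on_add:
  assumes "open S" "smooth_on S f" "smooth_on S g"
  shows "smooth_on S (\<lambda>x. f x + g x)"
  using assms by (simp add: smooth_on_def Ck_on_add)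

lemma Ck_on_bilinear:
  assumes "bounded_bilinear b" and "open S" "Ck_on k S f" "Ck_on k S g"
  shows "Ck_on k S (\<lambda>x. b (f x) (g x))"
  using assms(3,4)
proof (induction k arbitrary: f g)
  case 0
  then show ?case by (simp add: bounded_bilinear.continuous_on[OF assms(1)])
next
  case (Suc k)
  show ?case
  proof (rule Ck_on_SucI[OF assms(2), where
        D = "\<lambda>x v. b (f x) (frechet_derivative g (at x) v) + b (frechet_derivative f (at x) v) (g x)"])
    show "((\<lambda>x. b (f x) (g x)) has_derivative
        (\<lambda>v. b (f x) (frechet_derivative g (at x) v) + b (frechet_derivative f (at x) v) (g x))) (at x)"
      if "x \<in> S" for x
      using Suc.prems that by (intro bounded_bilinear.FDERIV[OF assms(1)]) (auto simp: frechet_derivative_works[symmetric])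
    show "Ck_on k S
        (\<lambda>x. b (f x) (frechet_derivative g (at x) v) + b (frechet_derivative f (at x) v) (g x))" for v
      using Suc.prems by (intro Ck_on_add assms(2) Suc.IH) (auto intro: Ck_on_SucD)
  qed
qed

lemma smooth_on_bilinear:
  assumes "bounded_bilinear b" "open S" "smooth_on S f" "smooth_on S g"
  shows "smooth_on S (\<lambda>x. b (f x) (g x))"
  using assms by (simp add: smooth_on_def Ck_on_bilinear)

lemmas smooth_on_scaleR = smooth_on_bilinear[OF bounded_bilinear_scaleR]

lemma Ck_on_inverse:
  fixes f :: "'a::real_normed_vector \<Rightarrow> real"
  assumes "open S" "Ck_on k S f" "\<And>x. x \<in> S \<Longrightarrow> f x \<noteq> 0"
  shows "Ck_on k S (\<lambda>x. inverse (f x))"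
  using assms(2)
proof (induction k)
  case 0
  then show ?case using assms(3) by (auto intro!: continuous_intros)
next
  case (Suc k)
  \<comment> \<open>The derivative of \<open>1/f\<close> is \<open>-(1/f)\<^sup>2 f'\<close>, and both factors are already \<open>C\<^sup>k\<close>.\<close>
  have inv: "Ck_on k S (\<lambda>x. inverse (f x))"
    by (rule Suc.IH) (rule Ck_on_SucD[OF Suc.prems])
  show ?case
  proof (rule Ck_on_SucI[OF assms(1), where
        D = "\<lambda>x v. (-1) * ((inverse (f x) * inverse (f x)) * frechet_derivative f (at x) v)"])
    show "((\<lambda>x. inverse (f x)) has_derivative
        (\<lambda>v. (-1) * ((inverse (f x) * inverse (f x)) * frechet_derivative f (at x) v))) (at x)"
      if "x \<in> S" for x
    proof -
      have "(f has_derivative frechet_derivative f (at x)) (at x)"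
        using Suc.prems that by (auto simp: frechet_derivative_works[symmetric])
      from Deriv.has_derivative_inverse[OF assms(3)[OF that] this] show ?thesis
        by (simp add: algebra_simps)
    qed
    show "Ck_on k S
        (\<lambda>x. (-1) * ((inverse (f x) * inverse (f x)) * frechet_derivative f (at x) v))" for v
      using Suc.prems
      by (intro Ck_on_bilinear[OF bounded_bilinear_mult] assms(1) inv Ck_on_const) simp
  qed
qed

lemma smooth_on_inverse:
  fixes f :: "'a::real_normed_vector \<Rightarrow> real"
  assumes "open S" "smooth_on S f" "\<And>x. x \<in> S \<Longrightarrow> f x \<noteq> 0"
  shows "smooth_on S (\<lambda>x. inverse (f x))"
  using assms by (simp add: smooth_on_def Ck_on_inverse)


section \<open>Linear charts\<close>

lemma chart_inv_apply: "inj_on f S \<Longrightarrow> p \<in> S \<Longrightarrow> chart_inv (S, f) (f p) = p"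
  by (simp add: chart_inv_def)

lemma open_image_linear_iso:
  assumes "open S" "bounded_linear g" "\<And>x. g (f x) = x" "\<And>y. f (g y) = y"
  shows "open (f ` S)"
proof -
  have "f ` S = g -` S"
    using assms(3) assms(4)[symmetric] by (auto intro!: image_eqI)
  then show ?thesis
    using assms(1,2) by (simp add: open_vimage linear_continuous_on)
qed

lemma is_chart_linear_iso:
  fixes f :: "'a::euclidean_space \<Rightarrow> 'b::euclidean_space"
  assumes "open S" "bounded_linear f" "bounded_linear g" "\<And>x. g (f x) = x" "\<And>y. f (g y) = y"
  shows "is_chart (top_of_set S) (S, f)"
proof -
  have "homeomorphic_maps (top_of_set S) (top_of_set (f ` S)) f g"
    using assms(2-4) by (auto simp: homeomorphic_maps_def linear_continuous_on)
  moreover have "open (f ` S)"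
    by (rule open_image_linear_iso) fact+
  ultimately show ?thesis
    by (simp add: is_chart_def homeomorphic_maps_map subtopology_subtopology)
qed

lemma smooth_manifold_open_subset:
  fixes S :: "'a::euclidean_space set"
  assumes "open S"
  shows "smooth_manifold (top_of_set S) {(S, id)}"
proof
  show "Hausdorff_space (top_of_set S)"
    by (simp add: Hausdorff_space_subtopology)
  obtain B :: "'a set set" where "countable B" "\<And>C. C \<in> B \<Longrightarrow> open C"
    and "\<And>T. open T \<Longrightarrow> \<exists>U. U \<subseteq> B \<and> T = \<Union>U"
    using univ_second_countable by blast
  then have "second_countable (euclidean :: 'a topology)"
    unfolding second_countable_def by (intro exI[of _ B]) (simp, blast)
  then show "second_countable (top_of_set S)"
    by (rule second_countable_subtopology)
  show "is_chart (top_of_set S) c" if "c \<in> {(S, id)}" for c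
    using that is_chart_linear_iso[of S id id] assms bounded_linear_ident
    by (simp add: id_def)
  have "smooth_on S (transition (S, id) (S, id))"
    by (rule smooth_on_cong[OF assms _ smooth_on_bounded_linear[OF bounded_linear_ident]])
      (simp add: transition_def chart_inv_def)
  then show "smooth_compatible c d" if "c \<in> {(S, id)}" "d \<in> {(S, id)}" for c d
    using that by (simp add: smooth_compatible_def transition_dom_def)
qed simp

lemma smooth_compatible_linear_iso:
  fixes f :: "'a::euclidean_space \<Rightarrow> 'b::euclidean_space"
  assumes "open S" "bounded_linear f" "bounded_linear g" "\<And>x. g (f x) = x" "\<And>y. f (g y) = y"
  shows "smooth_compatible (S, id) (S, f)"
proof -
  have inj: "inj_on f S"
    using assms(4) by (metis inj_onI)
  have "smooth_on S (transition (S, id) (S, f))"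
    by (rule smooth_on_cong[OF assms(1) _ smooth_on_bounded_linear[OF assms(2)]])
      (simp add: transition_def chart_inv_def)
  moreover have "smooth_on (f ` S) (transition (S, f) (S, id))"
    by (rule smooth_on_cong[OF open_image_linear_iso _ smooth_on_bounded_linear[OF assms(3)]])
      (use assms inj in \<open>auto simp: transition_def chart_inv_apply\<close>)
  ultimately show ?thesis
    by (simp add: smooth_compatible_def transition_dom_def)
qed


section \<open>The group of dilations and translations of the half-space\<close>

text \<open>The second coordinate is the height, because it becomes \<open>Im z\<^sub>1\<close> below.\<close>

definition half_space :: "(real^4) set" where
  "half_space = {p. 0 < p $ 2}"

definition base_point :: "real^4" where
  "base_point = axis 2 1"

text \<open>The point \<open>p\<close> stands for the map \<open>q \<mapsto> p\<^sub>2 q + (p - p\<^sub>2 base_point)\<close>, the only dilation followed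
  by a horizontal translation that takes the base point to \<open>p\<close>.\<close>

definition half_space_group :: "(real^4) monoid" where
  "half_space_group =
     \<lparr>carrier = half_space, mult = (\<lambda>p q. p + p $ 2 *\<^sub>R (q - base_point)), one = base_point\<rparr>"

lemma base_point_height [simp]: "base_point $ 2 = 1"
  by (simp add: base_point_def axis_def)

lemma carrier_half_space_group [simp]: "carrier half_space_group = half_space"
  and mult_half_space_group:
    "p \<otimes>\<^bsub>half_space_group\<^esub> q = p + p $ 2 *\<^sub>R (q - base_point)"
  and one_half_space_group [simp]: "\<one>\<^bsub>half_space_group\<^esub> = base_point"
  by (simp_all add: half_space_group_def)

lemma open_half_space: "open half_space"
  unfolding half_space_def by (intro open_Collect_less continuous_intros)

lemma height_mult: "(p \<otimes>\<^bsub>half_space_group\<^esub> q) $ 2 = p $ 2 * q $ 2"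
  by (simp add: mult_half_space_group algebra_simps)

lemma inverse_mult:
  assumes "p \<in> half_space"
  shows "(base_point + inverse (p $ 2) *\<^sub>R (base_point - p)) \<otimes>\<^bsub>half_space_group\<^esub> p = base_point"
  using assms by (simp add: mult_half_space_group half_space_def vec_eq_iff field_simps)

lemma inverse_in_half_space:
  "p \<in> half_space \<Longrightarrow> base_point + inverse (p $ 2) *\<^sub>R (base_point - p) \<in> half_space"
  by (simp add: half_space_def field_simps)

lemma group_half_space_group: "group half_space_group"
proof (rule groupI)
  show "\<exists>y\<in>carrier half_space_group. y \<otimes>\<^bsub>half_space_group\<^esub> x = \<one>\<^bsub>half_space_group\<^esub>"
    if "x \<in> carrier half_space_group" for x
    using that inverse_mult inverse_in_half_space by auto
next
  fix x y z
  show "x \<otimes>\<^bsub>half_space_group\<^esub> y \<otimes>\<^bsub>half_space_group\<^esub> z =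
      x \<otimes>\<^bsub>half_space_group\<^esub> (y \<otimes>\<^bsub>half_space_group\<^esub> z)"
    by (simp add: mult_half_space_group vec_eq_iff algebra_simps)
next
  fix x y assume "x \<in> carrier half_space_group" "y \<in> carrier half_space_group"
  then show "x \<otimes>\<^bsub>half_space_group\<^esub> y \<in> carrier half_space_group"
    using height_mult[of x y] by (simp add: half_space_def)
next
  show "\<one>\<^bsub>half_space_group\<^esub> \<in> carrier half_space_group"
    by (simp add: half_space_def)
qed (simp add: mult_half_space_group)

lemma inv_half_space_group:
  assumes "p \<in> half_space"
  shows "inv\<^bsub>half_space_group\<^esub> p = base_point + inverse (p $ 2) *\<^sub>R (base_point - p)"
  using group.inv_equality[OF group_half_space_group] inverse_mult inverse_in_half_space assms
  by simp

lemma (in group) solvable_if_commutators_in_abelian_subgroup: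
  assumes N: "subgroup N G" and comm: "\<And>x y. x \<in> N \<Longrightarrow> y \<in> N \<Longrightarrow> x \<otimes> y = y \<otimes> x"
    and deriv: "\<And>x y. x \<in> carrier G \<Longrightarrow> y \<in> carrier G \<Longrightarrow> x \<otimes> y \<otimes> inv x \<otimes> inv y \<in> N"
  shows "solvable G"
proof -
  have "derived G (carrier G) \<subseteq> N"
    unfolding derived_def by (rule generate_subgroup_incl[OF _ N]) (use deriv in auto)
  moreover have "x \<otimes> y \<otimes> inv x \<otimes> inv y = \<one>" if "x \<in> N" "y \<in> N" for x y
  proof -
    have xy: "x \<in> carrier G" "y \<in> carrier G"
      using that subgroup.mem_carrier[OF N] by auto
    have "x \<otimes> y \<otimes> inv x \<otimes> inv y = y \<otimes> (x \<otimes> inv x) \<otimes> inv y"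
      using xy by (subst comm[OF that]) (simp add: m_assoc)
    with xy show ?thesis by simp
  qed
  then have "derived G N \<subseteq> {\<one>}"
    unfolding derived_def by (intro generate_subgroup_incl triv_subgroup) auto
  ultimately have "derived G (derived G (carrier G)) \<subseteq> {\<one>}"
    using mono_derived by blast
  then have "(derived G ^^ 2) (carrier G) \<subseteq> {\<one>}"
    by (simp add: numeral_2_eq_2)
  moreover have "\<one> \<in> (derived G ^^ 2) (carrier G)"
    by (intro subgroup.one_closed exp_of_derived_is_subgroup subgroup_self)
  ultimately show ?thesis
    unfolding solvable_iff_trivial_derived_seq by blast
qed

text \<open>The height is a homomorphism to the multiplicative group of positive reals, and its kernel,
  the horosphere of height one, is the group of horizontal translations.\<close>

lemma solvable_half_space_group: "solvable half_space_group"
proof -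
  interpret group half_space_group
    by (rule group_half_space_group)
  have height_inv: "(inv\<^bsub>half_space_group\<^esub> x) $ 2 = inverse (x $ 2)" if "x \<in> half_space" for x
    using that by (simp add: inv_half_space_group half_space_def field_simps)
  show ?thesis
  proof (rule solvable_if_commutators_in_abelian_subgroup[where N = "{p. p $ 2 = 1}"])
    show "subgroup {p. p $ 2 = 1} half_space_group"
    proof (rule subgroupI)
      show "{p :: real^4. p $ 2 = 1} \<noteq> {}"
        using base_point_height by blast
    qed (auto simp: height_mult height_inv half_space_def)
    show "x \<otimes>\<^bsub>half_space_group\<^esub> y = y \<otimes>\<^bsub>half_space_group\<^esub> x"
      if "x \<in> {p. p $ 2 = 1}" "y \<in> {p. p $ 2 = 1}" for x y
      using that by (simp add: mult_half_space_group)
    show "x \<otimes>\<^bsub>half_space_group\<^esub> y \<otimes>\<^bsub>half_space_group\<^esub> inv\<^bsub>half_space_group\<^esub> x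
        \<otimes>\<^bsub>half_space_group\<^esub> inv\<^bsub>half_space_group\<^esub> y \<in> {p. p $ 2 = 1}"
      if "x \<in> carrier half_space_group" "y \<in> carrier half_space_group" for x y
      using that by (auto simp: height_mult height_inv half_space_def field_simps)
  qed
qed

lemma lie_group_half_space_group:
  "lie_group half_space_group (top_of_set half_space) {(half_space, id)}"
proof -
  let ?G = half_space_group and ?S = half_space
  have S: "open ?S"
    by (rule open_half_space)
  have mult_closed: "x \<otimes>\<^bsub>?G\<^esub> y \<in> ?S" if "x \<in> ?S" "y \<in> ?S" for x y
    using that height_mult[of x y] by (simp add: half_space_def)
  have inv_closed: "inv\<^bsub>?G\<^esub> x \<in> ?S" if "x \<in> ?S" for x
    using that group.inv_closed[OF group_half_space_group] by simp
  have "continuous_on (?S \<times> ?S) (\<lambda>(x, y). x \<otimes>\<^bsub>?G\<^esub> y)"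
    unfolding mult_half_space_group case_prod_beta by (intro continuous_intros)
  then have mult_cont: "continuous_map (prod_topology (top_of_set ?S) (top_of_set ?S)) (top_of_set ?S)
      (\<lambda>(x, y). x \<otimes>\<^bsub>?G\<^esub> y)"
    using mult_closed
    by (auto simp: prod_topology_subtopology_eu)
  have mult_smooth: "smooth_on (?S \<times> ?S) (\<lambda>p. fst p + fst p $ 2 *\<^sub>R (snd p + - base_point))"
    using S by (intro smooth_on_add smooth_on_scaleR smooth_on_const open_Times
        smooth_on_bounded_linear bounded_linear_fst bounded_linear_snd
        bounded_linear_compose[OF bounded_linear_vec_nth])
  have smooth_mult: "smooth_on (?S \<times> ?S)
      (id \<circ> (\<lambda>(x, y). x \<otimes>\<^bsub>?G\<^esub> y) \<circ> chart_inv (?S \<times> ?S, map_prod id id))"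
    by (rule smooth_on_cong[OF open_Times[OF S S] _ mult_smooth])
      (auto simp: chart_inv_def mult_half_space_group map_prod.id)
  have inv_smooth: "smooth_on ?S (\<lambda>p. base_point + inverse (p $ 2) *\<^sub>R (base_point + (-1) *\<^sub>R p))"
    using S by (intro smooth_on_add smooth_on_scaleR smooth_on_const smooth_on_inverse
        smooth_on_bounded_linear bounded_linear_vec_nth bounded_linear_ident)
      (auto simp: half_space_def)
  have smooth_inverse: "smooth_on ?S (id \<circ> m_inv ?G \<circ> chart_inv (?S, id))"
    by (rule smooth_on_cong[OF S _ inv_smooth])
      (auto simp: chart_inv_def inv_half_space_group)
  have "continuous_on ?S (\<lambda>p. base_point + inverse (p $ 2) *\<^sub>R (base_point - p))"
    by (intro continuous_intros) (auto simp: half_space_def)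
  then have inv_cont: "continuous_map (top_of_set ?S) (top_of_set ?S) (m_inv ?G)"
    using inv_closed by (auto simp: inv_half_space_group cong: continuous_on_cong)
  interpret group ?G
    by (rule group_half_space_group)
  interpret smooth_manifold "top_of_set ?S" "{(?S, id)}"
    by (rule smooth_manifold_open_subset[OF S])
  show ?thesis
  proof
    have "{p \<in> ?S \<times> ?S. (case p of (x, y) \<Rightarrow> x \<otimes>\<^bsub>?G\<^esub> y) \<in> ?S} = ?S \<times> ?S"
      using mult_closed by auto
    then show "smooth_map (prod_topology (top_of_set ?S) (top_of_set ?S))
        (product_atlas {(?S, id)} {(?S, id)}) (top_of_set ?S) {(?S, id)} (\<lambda>(x, y). x \<otimes>\<^bsub>?G\<^esub> y)"
      using mult_cont smooth_mult by (simp add: smooth_map_def product_atlas_def map_prod.id)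
    have "{p \<in> ?S. inv\<^bsub>?G\<^esub> p \<in> ?S} = ?S"
      using inv_closed by auto
    then show "smooth_map (top_of_set ?S) {(?S, id)} (top_of_set ?S) {(?S, id)} (m_inv ?G)"
      using inv_cont smooth_inverse by (simp add: smooth_map_def)
  qed simp
qed


section \<open>The left-invariant complex structure\<close>

definition to_C2 :: "real^4 \<Rightarrow> complex^2" where
  "to_C2 p = (\<chi> k. if k = 1 then Complex (p $ 1) (p $ 2) else Complex (p $ 3) (p $ 4))"

definition from_C2 :: "complex^2 \<Rightarrow> real^4" where
  "from_C2 z = (\<chi> i. if i = 1 then Re (z $ 1) else if i = 2 then Im (z $ 1)
     else if i = 3 then Re (z $ 2) else Im (z $ 2))"

lemma from_to_C2: "from_C2 (to_C2 p) = p"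
  by (simp add: from_C2_def to_C2_def vec_eq_iff forall_4)

lemma to_from_C2: "to_C2 (from_C2 z) = z"
  by (simp add: from_C2_def to_C2_def vec_eq_iff forall_2)

lemma bounded_linear_to_C2: "bounded_linear to_C2"
  by (intro linear_conv_bounded_linear[THEN iffD1] linearI)
    (simp_all add: to_C2_def vec_eq_iff complex_eq_iff)

lemma bounded_linear_from_C2: "bounded_linear from_C2"
  by (intro linear_conv_bounded_linear[THEN iffD1] linearI)
    (simp_all add: from_C2_def vec_eq_iff)

lemmas C2_linear_iso = bounded_linear_to_C2 bounded_linear_from_C2 from_to_C2 to_from_C2

lemma inj_on_to_C2: "inj_on to_C2 S"
  by (metis from_to_C2 inj_onI)

text \<open>The chart identifies the half-space with \<open>\<H> \<times> \<complex>\<close>.\<close>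

definition C2_chart :: "(real^4, complex^2) chart" where
  "C2_chart = (half_space, to_C2)"

lemma C2_chart_image: "to_C2 ` half_space = {z. 0 < Im (z $ 1)}"
proof -
  have "z \<in> to_C2 ` half_space" if "0 < Im (z $ 1)" for z
  proof (rule image_eqI)
    show "z = to_C2 (from_C2 z)"
      by (simp add: to_from_C2)
    show "from_C2 z \<in> half_space"
      using that by (simp add: half_space_def from_C2_def)
  qed
  then show ?thesis
    by (auto simp: to_C2_def half_space_def)
qed

lemma open_C2_chart_image: "open (to_C2 ` half_space)"
  by (rule open_image_linear_iso[OF open_half_space C2_linear_iso(2-4)])

lemma C2_chart_self_transition:
  "transition_dom C2_chart C2_chart = to_C2 ` half_space"
  "z \<in> to_C2 ` half_space \<Longrightarrow> transition C2_chart C2_chart z = z"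
  by (auto simp: transition_dom_def transition_def C2_chart_def chart_inv_apply inj_on_to_C2)

lemma holomorphic_vec_on_scaling:
  assumes "open S" "\<And>z. z \<in> S \<Longrightarrow> f z = a *\<^sub>R z + b"
  shows "holomorphic_vec_on S f"
  unfolding holomorphic_vec_on_def
proof (intro ballI exI conjI allI)
  fix z assume z: "z \<in> S"
  have "((\<lambda>z. a *\<^sub>R z + b) has_derivative (\<lambda>v. a *\<^sub>R v)) (at z)"
    by (auto intro!: derivative_eq_intros)
  then show "(f has_derivative (\<lambda>v. a *\<^sub>R v)) (at z)"
    by (rule has_derivative_transform_within_open[OF _ assms(1) z]) (simp add: assms(2))
  show "a *\<^sub>R (c *s v) = c *s (a *\<^sub>R v)" for c and v :: "complex^'a"
    by (simp add: vec_eq_iff)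
qed

lemma complex_structure_half_space:
  "complex_structure (top_of_set half_space) {(half_space, id)} {C2_chart}"
proof -
  interpret smooth_manifold "top_of_set half_space" "{(half_space, id)}"
    by (rule smooth_manifold_open_subset[OF open_half_space])
  show ?thesis
  proof
    show "is_chart (top_of_set half_space) c" if "c \<in> {C2_chart}" for c
      using that is_chart_linear_iso[OF open_half_space C2_linear_iso] by (simp add: C2_chart_def)
    show "holomorphic_vec_on (transition_dom c d) (transition c d)"
      if "c \<in> {C2_chart}" "d \<in> {C2_chart}" for c d
    proof -
      have "holomorphic_vec_on (to_C2 ` half_space) (transition C2_chart C2_chart)"
        by (rule holomorphic_vec_on_scaling[OF open_C2_chart_image, of _ 1 0])
          (simp add: C2_chart_self_transition)
      then show ?thesis
        using that by (simp add: C2_chart_self_transition)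
    qed
    show "smooth_compatible a c" if "a \<in> {(half_space, id)}" "c \<in> {C2_chart}" for a c
      using that smooth_compatible_linear_iso[OF open_half_space C2_linear_iso]
      by (simp add: C2_chart_def)
  qed (simp add: C2_chart_def)
qed

lemma left_invariant_half_space:
  "left_invariant half_space_group (top_of_set half_space) {C2_chart}"
  unfolding left_invariant_def
proof
  let ?G = half_space_group and ?S = half_space
  fix g assume "g \<in> carrier ?G"
  then have closed: "g \<otimes>\<^bsub>?G\<^esub> x \<in> ?S" if "x \<in> ?S" for x
    using that height_mult[of g x] by (simp add: half_space_def)
  have "continuous_on ?S (\<lambda>x. g \<otimes>\<^bsub>?G\<^esub> x)"
    unfolding mult_half_space_group by (intro continuous_intros)
  then have cont: "continuous_map (top_of_set ?S) (top_of_set ?S) (\<lambda>x. g \<otimes>\<^bsub>?G\<^esub> x)"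
    using closed by auto
  interpret to_C2: bounded_linear to_C2
    by (rule bounded_linear_to_C2)
  have "holomorphic_vec_on (to_C2 ` ?S) (to_C2 \<circ> (\<lambda>x. g \<otimes>\<^bsub>?G\<^esub> x) \<circ> chart_inv C2_chart)"
  proof (rule holomorphic_vec_on_scaling[OF open_C2_chart_image])
    show "(to_C2 \<circ> (\<lambda>x. g \<otimes>\<^bsub>?G\<^esub> x) \<circ> chart_inv C2_chart) z =
        g $ 2 *\<^sub>R z + to_C2 (g - g $ 2 *\<^sub>R base_point)" if "z \<in> to_C2 ` ?S" for z
      using that by (auto simp: C2_chart_def chart_inv_apply inj_on_to_C2 mult_half_space_group
          to_C2.add to_C2.diff to_C2.scaleR algebra_simps)
  qed
  moreover have "{p \<in> ?S. g \<otimes>\<^bsub>?G\<^esub> p \<in> ?S} = ?S"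
    using closed by auto
  ultimately show
    "holomorphic_map (top_of_set ?S) {C2_chart} (top_of_set ?S) {C2_chart} (\<lambda>x. g \<otimes>\<^bsub>?G\<^esub> x)"
    using cont by (simp add: holomorphic_map_def C2_chart_def)
qed


section \<open>Conformally flat Hermitian metrics\<close>

lemma sum_kronecker:
  fixes c :: "'a::semiring_0" and i :: "'n::finite"
  shows "(\<Sum>j\<in>UNIV. (if i = j then c else 0) * x j) = c * x i"
proof -
  have "(\<Sum>j\<in>UNIV. (if i = j then c else 0) * x j) = (\<Sum>j\<in>UNIV. if i = j then c * x j else 0)"
    by (intro sum.cong) auto
  then show ?thesis by simp
qed

lemma matrix_inv_mat:
  fixes c :: complex
  assumes "c \<noteq> 0"
  shows "matrix_inv (mat c :: complex^'n^'n) = mat (inverse c)"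
proof -
  have inv: "(mat c :: complex^'n^'n) ** mat (inverse c) = mat 1"
    "mat (inverse c) ** (mat c :: complex^'n^'n) = mat 1"
    using assms by (simp_all add: matrix_matrix_mult_def mat_def vec_eq_iff sum_kronecker)
  have "M = mat (inverse c)" if "mat c ** M = mat 1" for M :: "complex^'n^'n"
    by (metis inv(2) matrix_mul_assoc matrix_mul_lid matrix_mul_rid that)
  then show ?thesis
    unfolding matrix_inv_def using inv by (metis (mono_tags, lifting) someI)
qed

lemma upper_mat:
  fixes c :: complex
  shows "c \<noteq> 0 \<Longrightarrow> upper (mat c :: complex^'n^'n) p q = (if p = q then inverse c else 0)"
  by (simp add: upper_def matrix_inv_mat) (simp add: mat_def)

text \<open>For smooth positive \<open>u\<close> the sum on the right is \<open>- \<Delta> log u\<close>, with the derivatives of the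
  logarithm carried out. Scalar matrices commute with everything and stay scalar under
  differentiation, so the curvature is scalar as an endomorphism of the tangent space, and its
  trace with the metric is a scalar matrix.\<close>

lemma second_chern_ricci_conformally_flat:
  fixes u :: "complex^'n \<Rightarrow> complex"
  assumes "u z \<noteq> 0"
  shows "second_chern_ricci (\<lambda>x. mat (u x)) z =
    mat (\<Sum>i\<in>UNIV. d_hol i u z * d_antihol i u z / (u z)\<^sup>2 - d_hol i (d_antihol i u) z / u z)"
proof -
  have entry: "(\<lambda>x. mat (u x) $ k $ l) = (if k = l then u else (\<lambda>_. 0))" for k l :: 'n
    by (auto simp: mat_def)
  have hol_0: "d_hol i (\<lambda>_. 0) = (\<lambda>_. 0)" and antihol_0: "d_antihol i (\<lambda>_. 0) = (\<lambda>_. 0)" for i :: 'n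
    by (auto simp: d_hol_def d_antihol_def)
  have curv: "chern_curvature (\<lambda>x. mat (u x)) z i j k l =
      (if k = l then - d_hol i (d_antihol j u) z + d_hol i u z * d_antihol j u z / u z else 0)"
    for i j k l
  proof -
    have "(\<Sum>p\<in>UNIV. \<Sum>q\<in>UNIV. upper (mat (u z) :: complex^'n^'n) p q
          * d_hol i (\<lambda>x. mat (u x) $ k $ q) z * d_antihol j (\<lambda>x. mat (u x) $ p $ l) z) =
        (\<Sum>p\<in>UNIV. \<Sum>q\<in>UNIV. if q = p then if k = p then if p = l
          then inverse (u z) * d_hol i u z * d_antihol j u z else 0 else 0 else 0)"
      unfolding entry upper_mat[OF assms]
      by (intro sum.cong refl) (simp add: hol_0 antihol_0)
    also have "\<dots> = (if k = l then inverse (u z) * d_hol i u z * d_antihol j u z else 0)"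
      by (simp add: sum.delta sum.delta')
    finally show ?thesis
      by (simp add: chern_curvature_def entry hol_0 antihol_0 field_simps)
  qed
  have "second_chern_ricci (\<lambda>x. mat (u x)) z $ k $ l =
      (\<Sum>i\<in>UNIV. inverse (u z) * chern_curvature (\<lambda>x. mat (u x)) z i i k l)" for k l
    by (simp add: second_chern_ricci_def upper_mat[OF assms] sum_kronecker)
  then have "second_chern_ricci (\<lambda>x. mat (u x)) z $ k $ l = (if k = l then
      \<Sum>i\<in>UNIV. d_hol i u z * d_antihol i u z / (u z)\<^sup>2 - d_hol i (d_antihol i u) z / u z else 0)"
    for k l
    unfolding curv using assms by (auto simp: field_simps power2_eq_square intro!: sum.cong)
  then show ?thesis
    by (simp add: vec_eq_iff) (simp add: mat_def)
qed


section \<open>The hyperbolic metric on the half-space\<close>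

definition hyperbolic_density :: "complex^2 \<Rightarrow> complex" where
  "hyperbolic_density z = of_real (inverse (Im (z $ 1)) ^ 2)"

definition hyperbolic_metric :: "(real^4, 2) local_metrics" where
  "hyperbolic_metric c z = mat (hyperbolic_density z)"

text \<open>The constant factor allows the rule to be applied again to the first derivatives of the
  density, which are multiples of \<open>(Im z\<^sub>1)\<^sup>-\<^sup>3\<close>.\<close>

lemma has_derivative_inverse_height_power:
  fixes z :: "complex^2" and c :: complex
  assumes "0 < Im (z $ 1)"
  shows "((\<lambda>z. c * of_real (inverse (Im (z $ 1)) ^ n)) has_derivative
    (\<lambda>v. - c * of_nat n * of_real (Im (v $ 1)) * of_real (inverse (Im (z $ 1)) ^ Suc n))) (at z)"
proof -
  have D: "((\<lambda>z :: complex^2. Im (z $ 1)) has_derivative (\<lambda>v. Im (v $ 1))) (at z)"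
    by (intro bounded_linear_imp_has_derivative bounded_linear_compose[OF bounded_linear_Im]
        bounded_linear_vec_nth)
  have "((\<lambda>z. inverse (Im (z $ 1)) ^ n) has_derivative
      (\<lambda>v. - real n * Im (v $ 1) * inverse (Im (z $ 1)) ^ Suc n)) (at z)"
  proof (rule has_derivative_eq_rhs)
    show "((\<lambda>z. inverse (Im (z $ 1)) ^ n) has_derivative (\<lambda>v. of_nat n *
        - (inverse (Im (z $ 1)) * Im (v $ 1) * inverse (Im (z $ 1))) * inverse (Im (z $ 1)) ^ (n - 1)))
        (at z)"
      using assms by (intro has_derivative_power Deriv.has_derivative_inverse D) simp
  qed (cases n, auto simp: fun_eq_iff algebra_simps)
  from has_derivative_mult_right[OF has_derivative_of_real[OF this], of c] show ?thesis
    by (simp add: mult_ac)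
qed

lemma frechet_derivative_inverse_height_power:
  fixes z :: "complex^2" and c :: complex
  assumes "0 < Im (z $ 1)"
  shows "frechet_derivative (\<lambda>z. c * of_real (inverse (Im (z $ 1)) ^ n)) (at z) =
    (\<lambda>v. - c * of_nat n * of_real (Im (v $ 1)) * of_real (inverse (Im (z $ 1)) ^ Suc n))"
  using frechet_derivative_at[OF has_derivative_inverse_height_power[OF assms, of c n]] by simp

lemma d_hol_inverse_height_power:
  fixes z :: "complex^2"
  assumes "0 < Im (z $ 1)"
  shows "d_hol i (\<lambda>z. c * of_real (inverse (Im (z $ 1)) ^ n)) z =
    (if i = 1 then \<i> * c * of_nat n / 2 * of_real (inverse (Im (z $ 1)) ^ Suc n) else 0)"
  unfolding d_hol_def frechet_derivative_inverse_height_power[OF assms]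
  by (simp add: axis_def)

lemma d_antihol_inverse_height_power:
  fixes z :: "complex^2"
  assumes "0 < Im (z $ 1)"
  shows "d_antihol i (\<lambda>z. c * of_real (inverse (Im (z $ 1)) ^ n)) z =
    (if i = 1 then - \<i> * c * of_nat n / 2 * of_real (inverse (Im (z $ 1)) ^ Suc n) else 0)"
  unfolding d_antihol_def frechet_derivative_inverse_height_power[OF assms]
  by (simp add: axis_def)

text \<open>With \<open>y = Im z\<^sub>1\<close>, the density \<open>u = y\<^sup>-\<^sup>2\<close> has first derivatives \<open>\<plusminus>\<i> y\<^sup>-\<^sup>3\<close> and mixed second
  derivative \<open>(3/2) y\<^sup>-\<^sup>4\<close>; the factor is therefore \<open>1 - 3/2\<close>.\<close>

lemma second_chern_ricci_hyperbolic_metric: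
  assumes z: "z \<in> to_C2 ` half_space"
  shows "second_chern_ricci (hyperbolic_metric c) z = mat (- (1/2) * hyperbolic_density z)"
proof -
  have pos: "0 < Im (z $ 1)" if "z \<in> to_C2 ` half_space" for z
    using that by (simp add: C2_chart_image)
  have u: "hyperbolic_density = (\<lambda>z. 1 * of_real (inverse (Im (z $ 1)) ^ 2))"
    by (simp add: hyperbolic_density_def fun_eq_iff)
  have hol: "d_hol i hyperbolic_density z =
      (if i = 1 then \<i> * of_real (inverse (Im (z $ 1)) ^ 3) else 0)" for i
    unfolding u d_hol_inverse_height_power[OF pos[OF z]] by (simp add: numeral_3_eq_3 numeral_2_eq_2)
  have antihol: "d_antihol i hyperbolic_density z =
      (if i = 1 then - \<i> else 0) * of_real (inverse (Im (z $ 1)) ^ 3)"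
    if "z \<in> to_C2 ` half_space" for i z
    unfolding u d_antihol_inverse_height_power[OF pos[OF that]]
    by (simp add: numeral_3_eq_3 numeral_2_eq_2)
  have "d_hol i (d_antihol i hyperbolic_density) z =
      d_hol i (\<lambda>z. (if i = 1 then - \<i> else 0) * of_real (inverse (Im (z $ 1)) ^ 3)) z" for i
    unfolding d_hol_def
    using frechet_derivative_cong_open[OF open_C2_chart_image z antihol] by simp
  then have hol_antihol: "d_hol i (d_antihol i hyperbolic_density) z =
      (if i = 1 then 3 / 2 * of_real (inverse (Im (z $ 1)) ^ 4) else 0)" for i
    unfolding d_hol_inverse_height_power[OF pos[OF z]] by (simp add: eval_nat_numeral)
  have nz: "hyperbolic_density z \<noteq> 0"
    using pos[OF z] by (simp add: hyperbolic_density_def)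
  have "second_chern_ricci (hyperbolic_metric c) z =
      second_chern_ricci (\<lambda>x. mat (hyperbolic_density x)) z"
    by (simp add: hyperbolic_metric_def[abs_def])
  also have "\<dots> = mat (- (1/2) * hyperbolic_density z)"
    unfolding second_chern_ricci_conformally_flat[of hyperbolic_density z, OF nz]
      hol hol_antihol antihol[OF z] sum_2
    using pos[OF z] by (simp add: hyperbolic_density_def field_simps eval_nat_numeral)
  finally show ?thesis .
qed

lemma form11_mat:
  "form11 (mat c) u v = c * form11 (mat 1) u v"
proof -
  have "mat c $ k $ l = c * mat 1 $ k $ l" for k l :: 'a
    by (simp add: mat_def)
  then show ?thesis
    by (simp add: form11_def sum_distrib_left mult_ac)
qed

lemma hermitian_posdef_mat:
  assumes "0 < r"
  shows "hermitian_posdef (mat (of_real r) :: complex^'n^'n)"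
  unfolding hermitian_posdef_def
proof (intro conjI allI impI)
  fix v :: "complex^'n" assume "v \<noteq> 0"
  then obtain i where "v $ i \<noteq> 0"
    by (auto simp: vec_eq_iff)
  with assms have "0 < (\<Sum>k\<in>UNIV. r * (cmod (v $ k))\<^sup>2)"
    by (intro sum_pos2[of _ i]) auto
  moreover have "(\<Sum>l\<in>UNIV. mat (of_real r) $ k $ l * v $ k * cnj (v $ l)) =
      of_real (r * (cmod (v $ k))\<^sup>2)" for k
    by (simp add: mat_def mult.assoc sum_kronecker complex_norm_square del: of_real_power)
  ultimately show "0 < Re (\<Sum>k\<in>UNIV. \<Sum>l\<in>UNIV. mat (of_real r) $ k $ l * v $ k * cnj (v $ l))"
    by simp
qed (simp add: mat_def)

lemma hermitian_hyperbolic_metric: "hermitian_metric {C2_chart} hyperbolic_metric"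
proof -
  let ?U = "to_C2 ` half_space"
  have pos: "0 < Im (z $ 1)" if "z \<in> ?U" for z
    using that by (simp add: C2_chart_image)
  have metric: "hyperbolic_metric c z =
      inverse (Im (z $ 1)) *\<^sub>R inverse (Im (z $ 1)) *\<^sub>R mat 1" for c z
    by (simp add: hyperbolic_metric_def hyperbolic_density_def vec_eq_iff)
      (simp add: mat_def power2_eq_square scaleR_conv_of_real)
  have "smooth_on ?U (\<lambda>z. inverse (Im (z $ 1)))"
    using pos by (intro smooth_on_inverse open_C2_chart_image smooth_on_bounded_linear
        bounded_linear_compose[OF bounded_linear_Im] bounded_linear_vec_nth) force
  then have "smooth_on ?U (\<lambda>z. inverse (Im (z $ 1)) *\<^sub>R inverse (Im (z $ 1)) *\<^sub>R
      (mat 1 :: complex^2^2))"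
    by (intro smooth_on_scaleR open_C2_chart_image smooth_on_const)
  then have "smooth_on ?U (hyperbolic_metric c)" for c
    by (simp add: metric[abs_def])
  moreover have "hermitian_posdef (hyperbolic_metric c z)" if "z \<in> ?U" for c z
    unfolding hyperbolic_metric_def hyperbolic_density_def
    by (rule hermitian_posdef_mat) (use pos[OF that] in simp)
  moreover have "frechet_derivative (transition C2_chart C2_chart) (at z) = id" if "z \<in> ?U" for z
    using frechet_derivative_cong_open[OF open_C2_chart_image that, of _ id]
    by (simp add: C2_chart_self_transition)
  ultimately show ?thesis
    by (simp add: hermitian_metric_def C2_chart_self_transition)
      (simp add: C2_chart_def)
qed

text \<open>With \<open>z\<^sub>1 = x + \<i> y\<close>, the component of \<open>d(y\<^sup>-\<^sup>2 \<omega>\<^sub>0) = -2 y\<^sup>-\<^sup>3 dy \<and> \<omega>\<^sub>0\<close> on \<open>\<partial>\<^sub>y\<close> and the real and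
  imaginary directions of \<open>z\<^sub>2\<close> does not vanish.\<close>

lemma not_kahler_hyperbolic_metric: "\<not> kahler {C2_chart} hyperbolic_metric"
proof
  assume kahler: "kahler {C2_chart} hyperbolic_metric"
  define z :: "complex^2" where "z = axis 1 \<i>"
  define u v w :: "complex^2" where "u = axis 1 \<i>" and "v = axis 2 1" and "w = axis 2 \<i>"
  have z: "0 < Im (z $ 1)" "z \<in> to_C2 ` half_space"
    unfolding C2_chart_image by (simp_all add: z_def axis_def)
  have form: "form11 (hyperbolic_metric C2_chart x) a b =
      form11 (mat 1) a b * of_real (inverse (Im (x $ 1)) ^ 2)" for x a b
    unfolding hyperbolic_metric_def hyperbolic_density_def
    by (subst form11_mat) (rule mult.commute)
  have "ext_deriv2 (\<lambda>x. form11 (hyperbolic_metric C2_chart x)) z u v w = - 4"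
    unfolding ext_deriv2_def form frechet_derivative_inverse_height_power[OF z(1)]
    by (simp add: form11_def sum_2 mat_def z_def u_def v_def w_def axis_def)
  moreover have "ext_deriv2 (\<lambda>x. form11 (hyperbolic_metric C2_chart x)) z u v w = 0"
  proof -
    have "z \<in> snd C2_chart ` fst C2_chart"
      using z(2) by (simp add: C2_chart_def)
    with kahler show ?thesis unfolding kahler_def by blast
  qed
  ultimately show False
    by simp
qed

lemma einstein_hyperbolic_metric:
  "strong_second_chern_einstein {C2_chart} hyperbolic_metric (- (1/2))"
proof -
  have "form11 (second_chern_ricci (hyperbolic_metric c) z) u v =
      of_real (- (1/2)) * form11 (hyperbolic_metric c z) u v"
    if "z \<in> to_C2 ` half_space" for c z u v
    unfolding second_chern_ricci_hyperbolic_metric[OF that] hyperbolic_metric_def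
    by (subst (1 2) form11_mat) simp
  then show ?thesis
    by (simp add: strong_second_chern_einstein_def C2_chart_def)
qed

theorem theorem3:
  shows "\<exists>(G :: (real^4) monoid) (X :: (real^4) topology)
           (A :: (real^4, real^4) chart set) (B :: (real^4, complex^2) chart set).
           lie_group G X A \<and> solvable G \<and>
           complex_structure X A B \<and> left_invariant G X B \<and>
           (\<exists>(h :: (real^4, 2) local_metrics) (einstein_factor :: real).
              hermitian_metric B h \<and> \<not> kahler B h \<and>
              einstein_factor < 0 \<and> strong_second_chern_einstein B h einstein_factor)"
proof -
  have "- (1/2) < (0::real)"
    by simp
  then show ?thesis
    using lie_group_half_space_group solvable_half_space_group complex_structure_half_space
      left_invariant_half_space hermitian_hyperbolic_metric not_kahler_hyperbolic_metric
      einstein_hyperbolic_metric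
    by blast
qed

end
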